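(* Every nonconvex $4$-periodic billiard trajectory within an ellipse has a hyperbola as a caustic and is a Darboux butterfly.
   Context: A billiard trajectory within an ellipse $\mathcal{E}$ is a polygonal line with vertices on $\mathcal{E}$ such that any two consecutive sides satisfy the billiard reflection law: they form congruent angles with the tangent line to $\mathcal{E}$ at their joint vertex. A $4$-periodic trajectory is one that closes after four reflections, so that it is a closed polygonal line with four sides, the reflection law holding at each of its vertices; it is nonconvex if it is not a convex quadrilateral. A caustic of a billiard trajectory is a curve such that each segment of the trajectory lies on a tangent line of that curve; for billiards within an ellipse $\mathcal{E}$, caustics are ellipses and hyperbolas confocal with $\mathcal{E}$, including degenerate ones, which can be identified as the axes of $\mathcal{E}$. A Darboux butterfly is any closed polygonal self-intersecting line $ABCD$ (with sides $AB$, $BC$, $CD$, $DA$) such that $AB\cong CD$ and $AD\cong BC$.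
   Formalization: An asymptote of the hyperbola counts as a tangent line (tangent at infinity), since some butterflies have two sides through the centre, which no finite tangent contains; 4-periodic means least period 4. *)

theory Defs
  imports "HOL-Analysis.Analysis"
begin

section \<open>Confocal conics in the Euclidean plane\<close>

text \<open>Conics are given by their foci, in arbitrary position, so that two conics are confocal when
  they have the same \<open>F\<close> and \<open>G\<close>.  The set \<open>ellipse F G a\<close> is a nondegenerate ellipse
  (a circle if \<open>F = G\<close>) iff \<open>dist F G < 2 * a\<close>, and \<open>hyperbola F G c\<close> is a nondegenerate
  hyperbola, with both branches, iff \<open>0 < 2 * c\<close> and \<open>2 * c < dist F G\<close>.\<close>

definition ellipse :: "real^2 \<Rightarrow> real^2 \<Rightarrow> real \<Rightarrow> (real^2) set" where
  "ellipse F G a = {X. dist X F + dist X G = 2 * a}"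

definition hyperbola :: "real^2 \<Rightarrow> real^2 \<Rightarrow> real \<Rightarrow> (real^2) set" where
  "hyperbola F G c = {X. \<bar>dist X F - dist X G\<bar> = 2 * c}"

section \<open>Tangent lines\<close>

definition tangent_vector :: "(real^2) set \<Rightarrow> real^2 \<Rightarrow> real^2 \<Rightarrow> bool" where
  "tangent_vector S Q v \<longleftrightarrow>
     v \<noteq> 0 \<and> (\<exists>\<gamma> :: real \<Rightarrow> real^2. (\<forall>t. \<gamma> t \<in> S) \<and> continuous_on UNIV \<gamma> \<and>
       \<gamma> 0 = Q \<and> (\<gamma> has_vector_derivative v) (at 0))"

definition line_through :: "real^2 \<Rightarrow> real^2 \<Rightarrow> (real^2) set" where
  "line_through Q v = range (\<lambda>s. Q + s *\<^sub>R v)"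

definition asymptote :: "(real^2) set \<Rightarrow> (real^2) set \<Rightarrow> bool" where
  "asymptote S L \<longleftrightarrow>
     (\<exists>Q v. v \<noteq> 0 \<and> L = line_through Q v) \<and>
     (\<exists>\<gamma> :: real \<Rightarrow> real^2. (\<forall>t. \<gamma> t \<in> S) \<and> continuous_on UNIV \<gamma> \<and>
       filterlim \<gamma> at_infinity at_top \<and> ((\<lambda>t. infdist (\<gamma> t) L) \<longlongrightarrow> 0) at_top)"

text \<open>Tangency is understood projectively, as is usual for caustics: an asymptote is the tangent
  line at a point at infinity.  This cannot be dropped: in the ellipse with half-axes 2 and 1, the
  self-intersecting trajectory through the vertices of a rectangle has two of its sides on the
  asymptotes of its confocal caustic.\<close>

definition tangent_line :: "(real^2) set \<Rightarrow> (real^2) set \<Rightarrow> bool" where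
  "tangent_line S L \<longleftrightarrow>
     (\<exists>Q v. tangent_vector S Q v \<and> L = line_through Q v) \<or> asymptote S L"

section \<open>Billiard trajectories\<close>

definition vangle :: "real^2 \<Rightarrow> real^2 \<Rightarrow> real" where
  "vangle u v = arccos ((u \<bullet> v) / (norm u * norm v))"

text \<open>The rays \<open>BA\<close> and \<open>BC\<close> form congruent angles with the two opposite rays of the tangent
  line at \<open>B\<close>.  Since \<open>A\<close> and \<open>C\<close> lie on the same side of that tangent when \<open>S\<close> is an ellipse,
  this is reflection in the normal; normal incidence (\<open>A = C\<close>) is allowed.\<close>

definition reflection_law :: "(real^2) set \<Rightarrow> real^2 \<Rightarrow> real^2 \<Rightarrow> real^2 \<Rightarrow> bool" where
  "reflection_law S A B C \<longleftrightarrow>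
     (\<exists>v. tangent_vector S B v \<and> vangle (A - B) v = vangle (C - B) (- v))"

definition billiard_trajectory :: "(real^2) set \<Rightarrow> (nat \<Rightarrow> real^2) \<Rightarrow> bool" where
  "billiard_trajectory S P \<longleftrightarrow>
     (\<forall>i. P i \<in> S \<and> P i \<noteq> P (Suc i) \<and> reflection_law S (P i) (P (Suc i)) (P (Suc (Suc i))))"

text \<open>The period is the least one, so that a 2-periodic trajectory traversed twice is not
  4-periodic.\<close>

definition periodic_trajectory :: "nat \<Rightarrow> (nat \<Rightarrow> real^2) \<Rightarrow> bool" where
  "periodic_trajectory n P \<longleftrightarrow>
     0 < n \<and> (\<forall>i. P (i + n) = P i) \<and> (\<forall>m. 0 < m \<and> m < n \<longrightarrow> \<not> (\<forall>i. P (i + m) = P i))"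

definition caustic :: "(real^2) set \<Rightarrow> (nat \<Rightarrow> real^2) \<Rightarrow> bool" where
  "caustic S P \<longleftrightarrow> (\<forall>i. \<exists>L. tangent_line S L \<and> closed_segment (P i) (P (Suc i)) \<subseteq> L)"

section \<open>Quadrilaterals\<close>

text \<open>For each side, the other two vertices lie strictly on the same side of its line.\<close>

definition convex_quadrilateral :: "real^2 \<Rightarrow> real^2 \<Rightarrow> real^2 \<Rightarrow> real^2 \<Rightarrow> bool" where
  "convex_quadrilateral A B C D \<longleftrightarrow>
     closed_segment C D \<inter> affine hull {A, B} = {} \<and>
     closed_segment D A \<inter> affine hull {B, C} = {} \<and>
     closed_segment A B \<inter> affine hull {C, D} = {} \<and>
     closed_segment B C \<inter> affine hull {D, A} = {}"

text \<open>Self-intersection means that two opposite sides meet.  The limiting case \<open>B = D\<close>, in which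
  the polygonal line runs back and forth along \<open>ABC\<close>, is included.\<close>

definition darboux_butterfly :: "real^2 \<Rightarrow> real^2 \<Rightarrow> real^2 \<Rightarrow> real^2 \<Rightarrow> bool" where
  "darboux_butterfly A B C D \<longleftrightarrow>
     A \<noteq> B \<and> B \<noteq> C \<and> C \<noteq> D \<and> D \<noteq> A \<and>
     (closed_segment A B \<inter> closed_segment C D \<noteq> {} \<or>
      closed_segment B C \<inter> closed_segment D A \<noteq> {}) \<and>
     dist A B = dist C D \<and> dist A D = dist B C"

end

theory Submission
  imports Defs "HOL-Real_Asymp.Real_Asymp"
begin

text \<open>
  In coordinates along the axes, write the vertices as \<open>(a c, b s)\<close> with \<open>c\<^sup>2 + s\<^sup>2 = 1\<close>.  The
  reflection law makes the Joachimsthal integral \<open>J\<close> the same for all sides, which turns into the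
  bilinear relation \<open>(1 - K) c c' + (1 + K) s s' = 1 - M\<close> between consecutive vertices, where
  \<open>K = J\<^sup>2 (a\<^sup>2 - b\<^sup>2)\<close> and \<open>M = J\<^sup>2 (a\<^sup>2 + b\<^sup>2)\<close>.  So both neighbours of a vertex lie on a line
  determined by it.  For period 4 this leaves \<open>M = 1\<close>, which gives parallelograms, and \<open>K = 1\<close>, where
  \<open>s s' = - b\<^sup>2 / (a\<^sup>2 - b\<^sup>2)\<close> for every side, so that the trajectory is symmetric in the minor axis.
  The case of two equal opposite vertices, where the relation becomes a tangency, is treated through
  normal incidence and leads to the same formulas.  The product \<open>s s'\<close> alone forces each side to
  touch the hyperbola with squared half-axes \<open>p = a\<^sup>2 (a\<^sup>2 - 2 b\<^sup>2) / (a\<^sup>2 - b\<^sup>2)\<close> and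
  \<open>q = b\<^sup>4 / (a\<^sup>2 - b\<^sup>2)\<close>, and least period 4 forces \<open>2 b\<^sup>2 < a\<^sup>2\<close>.
\<close>

section \<open>The algebra of four chords\<close>

text \<open>With angles \<alpha> and \<beta> for the two points, the factors are twice the square of
  sin((\<alpha> - \<beta>) / 2) and twice the value of
  \<open>A * sin\<^sup>2 + B * cos\<^sup>2\<close> at (\<alpha> + \<beta>) / 2.\<close>

lemma chord_length_factor:
  fixes c s c' s' A B :: real
  assumes "c\<^sup>2 + s\<^sup>2 = 1" "c'\<^sup>2 + s'\<^sup>2 = 1"
  shows "A * (c - c')\<^sup>2 + B * (s - s')\<^sup>2 = (1 - c * c' - s * s') * (A + B - (A - B) * (c * c' - s * s'))"
  using assms by algebra

text \<open>Lagrange's identity for the chord and the tangent direction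
  \<open>(- a * s, b * c)\<close>, whose determinant is \<open>a * b * (1 - c * c' - s * s')\<close>
  up to sign.\<close>

lemma chord_tangent_component:
  fixes c s c' s' a b :: real
  assumes "c\<^sup>2 + s\<^sup>2 = 1" "c'\<^sup>2 + s'\<^sup>2 = 1"
  shows "(a * (c' - c) * (- a * s) + b * (s' - s) * (b * c))\<^sup>2
    = (a\<^sup>2 * (c - c')\<^sup>2 + b\<^sup>2 * (s - s')\<^sup>2) * (a\<^sup>2 * s\<^sup>2 + b\<^sup>2 * c\<^sup>2) - a\<^sup>2 * b\<^sup>2 * (1 - c * c' - s * s')\<^sup>2"
  using assms by algebra

lemma unit_parallel:
  fixes x y x' y' :: real
  assumes "x\<^sup>2 + y\<^sup>2 = 1" "x'\<^sup>2 + y'\<^sup>2 = 1" "x * y' = x' * y" "(x, y) \<noteq> (x', y')"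
  shows "x = - x' \<and> y = - y'"
proof -
  have "(x - x') * (x + x') = 0" "(y - y') * (y + y') = 0" "(x * x' + y * y')\<^sup>2 = 1"
    using assms(1-3) by algebra+
  then have "x * x' + y * y' = 1 \<or> x * x' + y * y' = -1" by algebra
  then have "(x - x')\<^sup>2 + (y - y')\<^sup>2 = 0 \<or> (x + x')\<^sup>2 + (y + y')\<^sup>2 = 0" using assms(1,2) by algebra
  then show ?thesis using assms(4) by (auto simp: sum_power2_eq_zero_iff)
qed

text \<open>Here \<open>A = a\<^sup>2\<close>, \<open>B = b\<^sup>2\<close> and \<open>k = J\<^sup>2\<close>.\<close>

lemma symmetric_shape:
  fixes c s :: "nat \<Rightarrow> real" and A B k :: real
  assumes AB: "0 < B" "B \<le> A"
    and circ: "\<And>i. (c i)\<^sup>2 + (s i)\<^sup>2 = 1"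
    and k: "k > 0"
    and rel: "\<And>i j. (i, j) \<in> {(0,1),(1,2),(2,3),(3,0)} \<Longrightarrow>
      1 - c i * c j - s i * s j = k * (A + B - (A - B) * (c i * c j - s i * s j))"
    and ne: "(c 0, s 0) \<noteq> (c 2, s 2)" "(c 1, s 1) \<noteq> (c 3, s 3)"
  shows "(c 2 = - c 0 \<and> s 2 = - s 0 \<and> c 3 = - c 1 \<and> s 3 = - s 1) \<or>
     (B < A \<and> c 2 = - c 0 \<and> s 2 = s 0 \<and> c 3 = - c 1 \<and> s 3 = s 1 \<and> s 0 * s 1 = - B / (A - B))"
proof -
  define K where "K = k * (A - B)"
  define M where "M = k * (A + B)"
  have R: "(1 - K) * c i * c j + (1 + K) * s i * s j = 1 - M" if "(i, j) \<in> {(0,1),(1,2),(2,3),(3,0)}" for i j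
    using rel[OF that] unfolding K_def M_def by (simp add: algebra_simps)
  have K0: "K \<ge> 0" and KM: "K < M" using AB k by (auto simp: K_def M_def)
  have r01: "(1 - K) * c 0 * c 1 + (1 + K) * s 0 * s 1 = 1 - M"
   and r12: "(1 - K) * c 1 * c 2 + (1 + K) * s 1 * s 2 = 1 - M"
   and r23: "(1 - K) * c 2 * c 3 + (1 + K) * s 2 * s 3 = 1 - M"
   and r30: "(1 - K) * c 3 * c 0 + (1 + K) * s 3 * s 0 = 1 - M"
    using R by auto
  show ?thesis
  proof (cases "M = 1")
    case True
    \<comment> \<open>For \<open>M = 1\<close> both neighbours of a vertex lie on a line through the
      centre, a genuine line because \<open>K < 1\<close>; distinct neighbours are then
      antipodal.\<close>
    have par: "x = - x' \<and> y = - y'" if "u\<^sup>2 + v\<^sup>2 = 1" "x\<^sup>2 + y\<^sup>2 = 1" "x'\<^sup>2 + y'\<^sup>2 = 1" "(x,y) \<noteq> (x',y')"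
       "(1 - K) * u * x + (1 + K) * v * y = 0" "(1 - K) * u * x' + (1 + K) * v * y' = 0" for u v x y x' y'
    proof (rule unit_parallel)
      have "(1 - K) * u \<noteq> 0 \<or> (1 + K) * v \<noteq> 0" using that(1) True KM K0 by auto
      moreover have "(1 - K) * u * (x * y' - x' * y) = 0" using that(5,6) by algebra
      moreover have "(1 + K) * v * (x * y' - x' * y) = 0" using that(5,6) by algebra
      ultimately show "x * y' = x' * y" by auto
    qed (use that in auto)
    have "c 1 = - c 3 \<and> s 1 = - s 3"
      by (rule par[OF circ[of 0]]) (use circ ne r01 r30 True in \<open>auto simp: algebra_simps\<close>)
    moreover have "c 0 = - c 2 \<and> s 0 = - s 2"
      by (rule par[OF circ[of 1]]) (use circ ne r01 r12 True in \<open>auto simp: algebra_simps\<close>)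
    ultimately show ?thesis by auto
  next
    case False
    \<comment> \<open>For \<open>M \<noteq> 1\<close> that line misses the centre, so distinct
      neighbours are linearly independent.\<close>
    have indep: "x * y' \<noteq> x' * y" if "u\<^sup>2 + v\<^sup>2 = 1" "x\<^sup>2 + y\<^sup>2 = 1" "x'\<^sup>2 + y'\<^sup>2 = 1" "(x,y) \<noteq> (x',y')"
       "(1 - K) * u * x + (1 + K) * v * y = 1 - M" "(1 - K) * u * x' + (1 + K) * v * y' = 1 - M" for u v x y x' y'
    proof
      assume "x * y' = x' * y"
      then have "x = - x' \<and> y = - y'" using unit_parallel that by blast
      then show False using that(5,6) False by algebra
    qed
    have i13: "c 1 * s 3 \<noteq> c 3 * s 1"
      by (rule indep[OF circ[of 0]]) (use circ ne r01 r30 in \<open>auto simp: algebra_simps\<close>)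
    \<comment> \<open>Subtracting the relations at vertices 1 and 3 makes the vector
      \<open>((1 - K) * (c 0 - c 2), (1 + K) * (s 0 - s 2))\<close> orthogonal to both of these
      independent vertices, so it vanishes.\<close>
    have "(1 - K) * (c 0 - c 2) * (c 1 * s 3 - c 3 * s 1) = 0" using r01 r12 r23 r30 by algebra
    then have a1: "(1 - K) * (c 0 - c 2) = 0" using i13 by simp
    have "(1 + K) * (s 0 - s 2) * (c 1 * s 3 - c 3 * s 1) = 0" using r01 r12 r23 r30 by algebra
    then have s02: "s 0 = s 2" using i13 K0 by simp
    then have K1: "K = 1" using a1 ne by auto
    then have AltB: "B < A" using AB by (cases "A = B") (auto simp: K_def)
    have c2: "c 2 = - c 0" using circ[of 0] circ[of 2] s02 ne
      by (metis add_right_cancel power2_eq_iff minus_minus)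
    have ss: "s 0 * s 1 = (1 - M) / 2" using r01 K1 by simp
    have "s 0 * s 3 = (1 - M) / 2" using r30 K1 by (simp add: algebra_simps)
    then have "s 0 * s 1 = s 0 * s 3" using ss by (rule trans[OF _ sym, rotated])
    moreover have "s 0 \<noteq> 0" using ss False by auto
    ultimately have s13: "s 1 = s 3" by (metis mult_left_cancel)
    have c3: "c 3 = - c 1" using circ[of 1] circ[of 3] s13 ne
      by (metis add_right_cancel power2_eq_iff minus_minus)
    have "k = 1 / (A - B)" using K1 AltB by (simp add: K_def field_simps)
    then have "(1 - M) / 2 = - B / (A - B)" using AltB by (simp add: M_def field_simps)
    with ss have "s 0 * s 1 = - B / (A - B)" by (rule trans)
    then show ?thesis using AltB s02[symmetric] c2 s13[symmetric] c3 by blast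
  qed
qed

text \<open>Here \<open>(c0, s0)\<close> is the vertex passed twice, and \<open>n1\<close>,
  \<open>n3\<close> express normal incidence at the two others. A normal chord determines
  \<open>k\<close> from the squared coordinates of its foot, so the two feet are mirror images in an
  axis.\<close>

lemma normal_shape:
  fixes c0 s0 c1 s1 c3 s3 A B k :: real
  assumes AB: "0 < B" "B \<le> A"
    and circ: "c0\<^sup>2 + s0\<^sup>2 = 1" "c1\<^sup>2 + s1\<^sup>2 = 1" "c3\<^sup>2 + s3\<^sup>2 = 1"
    and rel1: "1 - c0 * c1 - s0 * s1 = k * (A + B - (A - B) * (c0 * c1 - s0 * s1))"
    and rel3: "1 - c0 * c3 - s0 * s3 = k * (A + B - (A - B) * (c0 * c3 - s0 * s3))"
    and n1: "A * (c0 - c1) * s1 = B * (s0 - s1) * c1"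
    and n3: "A * (c0 - c3) * s3 = B * (s0 - s3) * c3"
    and ne: "(c0, s0) \<noteq> (c1, s1)" "(c0, s0) \<noteq> (c3, s3)" "(c1, s1) \<noteq> (c3, s3)"
  shows "B < A \<and> c0 = 0 \<and> c3 = - c1 \<and> s3 = s1 \<and> s0 * s1 = - B / (A - B)"
proof -
  \<comment> \<open>In the plane the ellipse has the normal \<open>(c / a, s / b)\<close> at
    \<open>(a * c, b * s)\<close>. The chord is \<open>- t\<close> times this normal,
    \<open>k\<close> is the squared length of the normal, and the last equation selects the second
    intersection with the ellipse.\<close>
  have *: "\<exists>t. c0 = c * (1 - t / A) \<and> s0 = s * (1 - t / B) \<and> k = c\<^sup>2 / A + s\<^sup>2 / B \<and>
       t * (c\<^sup>2 / A\<^sup>2 + s\<^sup>2 / B\<^sup>2) = 2 * k"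
     if cs: "c\<^sup>2 + s\<^sup>2 = 1" "A * (c0 - c) * s = B * (s0 - s) * c" "(c0, s0) \<noteq> (c, s)"
       "1 - c0 * c - s0 * s = k * (A + B - (A - B) * (c0 * c - s0 * s))" for c s
  proof -
    \<comment> \<open>The number \<open>u\<close> is \<open>t / (A * B)\<close>, which keeps the
      computation free of denominators.\<close>
    have "\<exists>u. c0 - c = - u * B * c \<and> s0 - s = - u * A * s"
    proof (cases "c = 0")
      case True
      then show ?thesis using cs AB by (intro exI[of _ "(s - s0) / (A * s)"]) auto
    next
      case False
      then show ?thesis using cs AB by (intro exI[of _ "(c - c0) / (B * c)"]) (auto simp: field_simps)
    qed
    then obtain u where u: "c0 = c - u * B * c" "s0 = s - u * A * s"
      by (auto simp: algebra_simps)
    have "u \<noteq> 0" using u cs(3) by auto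
    have h: "1 - c0 * c - s0 * s = u * (B * c\<^sup>2 + A * s\<^sup>2)"
      using cs(1) u by algebra
    have "(c - u * B * c)\<^sup>2 + (s - u * A * s)\<^sup>2 = 1" using circ u by simp
    then have "u * (u * (B\<^sup>2 * c\<^sup>2 + A\<^sup>2 * s\<^sup>2) - 2 * (B * c\<^sup>2 + A * s\<^sup>2)) = 0"
      using cs(1) by algebra
    then have t: "u * (B\<^sup>2 * c\<^sup>2 + A\<^sup>2 * s\<^sup>2) = 2 * (B * c\<^sup>2 + A * s\<^sup>2)" using \<open>u \<noteq> 0\<close> by simp
    have l: "A * (c0 - c)\<^sup>2 + B * (s0 - s)\<^sup>2 = u\<^sup>2 * A * B * (B * c\<^sup>2 + A * s\<^sup>2)"
      using u by algebra
    have pos: "B * c\<^sup>2 + A * s\<^sup>2 > 0"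
    proof -
      have "B * c\<^sup>2 + A * s\<^sup>2 = B + (A - B) * s\<^sup>2" using cs(1) by algebra
      then show ?thesis using AB by (simp add: add_pos_nonneg)
    qed
    \<comment> \<open>The squared chord length, computed along the normal and by its factorisation,
      gives the second factor, and hence \<open>k\<close>.\<close>
    have "u\<^sup>2 * A * B * (B * c\<^sup>2 + A * s\<^sup>2) = u * (B * c\<^sup>2 + A * s\<^sup>2) * (A + B - (A - B) * (c0 * c - s0 * s))"
      using chord_length_factor[OF circ(1) cs(1), of A B] unfolding l h by (simp add: algebra_simps)
    then have "u * (B * c\<^sup>2 + A * s\<^sup>2) * (u * A * B - (A + B - (A - B) * (c0 * c - s0 * s))) = 0"
      by algebra
    then have "A + B - (A - B) * (c0 * c - s0 * s) = u * A * B" using \<open>u \<noteq> 0\<close> pos by simp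
    then have "u * (B * c\<^sup>2 + A * s\<^sup>2) = u * (k * A * B)" using cs(4) h by (simp add: algebra_simps)
    then have kAB: "B * c\<^sup>2 + A * s\<^sup>2 = k * A * B" using \<open>u \<noteq> 0\<close> by simp
    then have k: "k = c\<^sup>2 / A + s\<^sup>2 / B" using AB by (simp add: field_simps)
    have "u * A * B * (c\<^sup>2 / A\<^sup>2 + s\<^sup>2 / B\<^sup>2) = u * (B\<^sup>2 * c\<^sup>2 + A\<^sup>2 * s\<^sup>2) / (A * B)"
      using AB by (simp add: field_simps power2_eq_square)
    also have "\<dots> = 2 * k" unfolding t kAB using AB by simp
    finally show ?thesis
      using AB u k by (intro exI[of _ "u * A * B"]) (simp add: algebra_simps)
  qed
  obtain t where t: "c0 = c1 * (1 - t / A)" "s0 = s1 * (1 - t / B)" "k = c1\<^sup>2 / A + s1\<^sup>2 / B"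
       "t * (c1\<^sup>2 / A\<^sup>2 + s1\<^sup>2 / B\<^sup>2) = 2 * k" using *[OF circ(2) n1 ne(1) rel1] by blast
  obtain t' where t': "c0 = c3 * (1 - t' / A)" "s0 = s3 * (1 - t' / B)" "k = c3\<^sup>2 / A + s3\<^sup>2 / B"
       "t' * (c3\<^sup>2 / A\<^sup>2 + s3\<^sup>2 / B\<^sup>2) = 2 * k" using *[OF circ(3) n3 ne(2) rel3] by blast
  have kk: "(A - B) * s1\<^sup>2 = k * A * B - B" "(A - B) * s3\<^sup>2 = k * A * B - B"
    using t(3) t'(3) circ(2,3) AB by (auto simp: field_simps) algebra+
  \<comment> \<open>In a circle normal chords are diameters, so both feet would be antipodal to
    \<open>(c0, s0)\<close> and coincide.\<close>
  have "A \<noteq> B"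
  proof
    assume "A = B"
    with kk AB have "k = 1 / A" by (simp add: field_simps)
    have "c1\<^sup>2 / A\<^sup>2 + s1\<^sup>2 / A\<^sup>2 = 1 / A\<^sup>2" "c3\<^sup>2 / A\<^sup>2 + s3\<^sup>2 / A\<^sup>2 = 1 / A\<^sup>2"
      using circ by (simp_all flip: add_divide_distrib)
    then have "t = 2 * A" "t' = 2 * A"
      using t(4) t'(4) AB \<open>A = B\<close> \<open>k = 1 / A\<close> by (simp_all add: field_simps power2_eq_square)
    then show False using t(1,2) t'(1,2) \<open>A = B\<close> AB ne by simp
  qed
  then have AltB: "B < A" using AB by simp
  have "(A - B) * s1\<^sup>2 = (A - B) * s3\<^sup>2" using kk by (rule trans[OF _ sym])
  then have s2: "s1\<^sup>2 = s3\<^sup>2" using \<open>A \<noteq> B\<close> by simp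
  then have c2: "c1\<^sup>2 = c3\<^sup>2" using circ by simp
  have "c1\<^sup>2 / A\<^sup>2 + s1\<^sup>2 / B\<^sup>2 \<noteq> 0"
  proof
    assume "c1\<^sup>2 / A\<^sup>2 + s1\<^sup>2 / B\<^sup>2 = 0"
    then have "c1 = 0 \<and> s1 = 0" using AB by (auto simp: add_nonneg_eq_0_iff)
    then show False using circ by simp
  qed
  then have tt: "t' = t" using t(4) t'(4) unfolding s2 c2 by (metis mult_right_cancel)
  show ?thesis
  proof (cases "s1 = s3")
    case True
    \<comment> \<open>The feet are mirror images in the minor axis, which must therefore contain the
      common vertex.\<close>
    then have c3: "c3 = - c1" "c1 \<noteq> c3" using c2 ne by (auto simp: power2_eq_iff)
    then have "c0 = - c0" using t(1) t'(1) tt by simp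
    then have "c0 = 0" by simp
    then have "t = A" using t(1) c3 AB by auto
    have "s0 * s0 = 1" using circ(1) \<open>c0 = 0\<close> by (simp add: power2_eq_square)
    have "s0 * B = - (s1 * (A - B))" using t(2) AB \<open>t = A\<close> by (simp add: field_simps)
    then have "s0 * s1 * (A - B) = - B" using \<open>s0 * s0 = 1\<close> by algebra
    then have "s0 * s1 = - B / (A - B)" using AltB by (simp add: field_simps)
    then show ?thesis using AltB \<open>c0 = 0\<close> c3 True by simp
  next
    case False
    \<comment> \<open>The feet are mirror images in the major axis, so the common vertex is an end
      of that axis. This would require \<open>\<bar>c1\<bar> = A / (A - B) > 1\<close>.\<close>
    then have s3: "s3 = - s1" using s2 by (auto simp: power2_eq_iff)
    then have "s0 = - s0" using t(2) t'(2) tt by simp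
    then have "s0 = 0" by simp
    then have "t = B" using t(2) s3 False AB by auto
    have "c0 * A = c1 * (A - B)" using t(1) AB \<open>t = B\<close> by (simp add: field_simps)
    moreover have "c0\<^sup>2 = 1" using circ(1) \<open>s0 = 0\<close> by simp
    ultimately have A2: "A\<^sup>2 = c1\<^sup>2 * (A - B)\<^sup>2" by algebra
    have "c1\<^sup>2 \<le> 1" using circ(2) zero_le_power2[of s1] by linarith
    then have "c1\<^sup>2 * (A - B)\<^sup>2 \<le> 1 * (A - B)\<^sup>2" by (rule mult_right_mono) simp
    then have "A \<le> A - B" using AltB A2 by (intro power2_le_imp_le[of A]) auto
    then show ?thesis using AB by simp
  qed
qed

section \<open>Reflections in coordinates along the axes\<close>

text \<open>The relation between the foci involves no division by \<open>f\<close>, so that circles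
  are covered: for \<open>f = 0\<close> any unit vector may serve as \<open>e\<close>.\<close>

locale focal_frame =
  fixes F G :: "real^2" and f :: real and e e' :: "real^2"
  assumes foci: "F - G = (2 * f) *\<^sub>R e"
    and f_nonneg: "0 \<le> f"
    and orthonormal: "e \<bullet> e = 1" "e' \<bullet> e' = 1" "e \<bullet> e' = 0"
    and frame_expansion: "v = (v \<bullet> e) *\<^sub>R e + (v \<bullet> e') *\<^sub>R e'"
begin

definition xc :: "real^2 \<Rightarrow> real" where "xc X = (X - midpoint F G) \<bullet> e"
definition yc :: "real^2 \<Rightarrow> real" where "yc X = (X - midpoint F G) \<bullet> e'"
definition pt :: "real \<Rightarrow> real \<Rightarrow> real^2" where "pt x y = midpoint F G + x *\<^sub>R e + y *\<^sub>R e'"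

lemma xc_pt [simp]: "xc (pt x y) = x" and yc_pt [simp]: "yc (pt x y) = y"
  using orthonormal by (simp_all add: xc_def yc_def pt_def inner_simps inner_commute)

lemma pt_coords [simp]: "pt (xc X) (yc X) = X"
  using frame_expansion[of "X - midpoint F G"] by (simp add: xc_def yc_def pt_def algebra_simps)

lemma coords_eqI: "xc X = xc Y \<Longrightarrow> yc X = yc Y \<Longrightarrow> X = Y"
  by (metis pt_coords)

lemma inner_frame: "u \<bullet> w = (u \<bullet> e) * (w \<bullet> e) + (u \<bullet> e') * (w \<bullet> e')"
  by (subst frame_expansion[of w]) (simp add: inner_simps)

lemma diff_inner [simp]: "(X - Y) \<bullet> e = xc X - xc Y" "(X - Y) \<bullet> e' = yc X - yc Y"
  by (simp_all add: xc_def yc_def inner_simps)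

lemma dist_coords: "(dist X Y)\<^sup>2 = (xc X - xc Y)\<^sup>2 + (yc X - yc Y)\<^sup>2"
  unfolding dist_norm power2_norm_eq_inner by (subst inner_frame) (simp add: power2_eq_square)

lemma foci_coords: "xc F = f" "yc F = 0" "xc G = - f" "yc G = 0"
proof -
  have "F = pt f 0" "G = pt (- f) 0"
    using foci by (simp_all add: pt_def midpoint_def vec_eq_iff field_simps)
  then show "xc F = f" "yc F = 0" "xc G = - f" "yc G = 0" by (metis xc_pt yc_pt)+
qed

lemma dist_foci: "dist F G = 2 * f"
  using foci orthonormal f_nonneg by (simp add: dist_norm norm_eq_1)

lemma ellipse_coords:
  assumes "X \<in> ellipse F G a" "f < a"
  shows "(xc X / a)\<^sup>2 + (yc X / sqrt (a\<^sup>2 - f\<^sup>2))\<^sup>2 = 1"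
proof -
  have a: "0 < a" "f\<^sup>2 < a\<^sup>2" using assms(2) f_nonneg by (auto intro: power_strict_mono)
  have sum: "dist X F + dist X G = 2 * a" using assms by (simp add: ellipse_def)
  have dF: "(dist X F)\<^sup>2 = (xc X - f)\<^sup>2 + (yc X)\<^sup>2" and dG: "(dist X G)\<^sup>2 = (xc X + f)\<^sup>2 + (yc X)\<^sup>2"
    by (simp_all add: dist_coords foci_coords)
  \<comment> \<open>The difference of the squared focal distances is \<open>- 4 * f * xc X\<close>;
    dividing by their sum \<open>2 * a\<close> makes each distance affine in
    \<open>xc X\<close>.\<close>
  have "a * dist X F = a\<^sup>2 - f * xc X" using sum dF dG by algebra
  then have "a\<^sup>2 * ((xc X - f)\<^sup>2 + (yc X)\<^sup>2) = (a\<^sup>2 - f * xc X)\<^sup>2" using dF by algebra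
  then have "(xc X)\<^sup>2 * (a\<^sup>2 - f\<^sup>2) + (yc X)\<^sup>2 * a\<^sup>2 = a\<^sup>2 * (a\<^sup>2 - f\<^sup>2)" by algebra
  then have "(xc X)\<^sup>2 / a\<^sup>2 + (yc X)\<^sup>2 / (a\<^sup>2 - f\<^sup>2) = 1" using a by (simp add: divide_simps)
  then show ?thesis using a by (simp add: power_divide)
qed

lemma ellipse_tangent_vector:
  assumes "tangent_vector (ellipse F G a) Q v" "f < a"
  shows "(xc Q / a) * ((v \<bullet> e) / a) + (yc Q / sqrt (a\<^sup>2 - f\<^sup>2)) * ((v \<bullet> e') / sqrt (a\<^sup>2 - f\<^sup>2)) = 0"
proof -
  obtain \<gamma> where \<gamma>: "\<And>t. \<gamma> t \<in> ellipse F G a" "\<gamma> 0 = Q" "(\<gamma> has_vector_derivative v) (at 0)"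
    using assms(1) unfolding tangent_vector_def by blast
  let ?b = "sqrt (a\<^sup>2 - f\<^sup>2)"
  have D: "((\<lambda>t. (\<gamma> t - midpoint F G) \<bullet> u) has_real_derivative v \<bullet> u) (at 0)" for u
  proof -
    have "((\<lambda>t. \<gamma> t - midpoint F G) has_vector_derivative v) (at 0)"
      using has_vector_derivative_diff[OF \<gamma>(3) has_vector_derivative_const] by simp
    from bounded_linear.has_vector_derivative[OF bounded_linear_inner_left this]
    show ?thesis by (simp add: has_real_derivative_iff_has_vector_derivative)
  qed
  have sq: "((\<lambda>t. (p t / k)\<^sup>2) has_real_derivative 2 * (p 0 / k) * (p' / k)) (at 0)"
    if "(p has_real_derivative p') (at 0)" for p :: "real \<Rightarrow> real" and p' k
    using DERIV_power[OF DERIV_cdivide[OF that], of k 2] by (simp add: algebra_simps)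
  have "((\<lambda>t. (xc (\<gamma> t) / a)\<^sup>2 + (yc (\<gamma> t) / ?b)\<^sup>2) has_real_derivative
      2 * (xc Q / a) * ((v \<bullet> e) / a) + 2 * (yc Q / ?b) * ((v \<bullet> e') / ?b)) (at 0)"
    using DERIV_add[OF sq[OF D] sq[OF D]] by (simp only: xc_def yc_def \<gamma>(2))
  moreover have "(\<lambda>t. (xc (\<gamma> t) / a)\<^sup>2 + (yc (\<gamma> t) / ?b)\<^sup>2) = (\<lambda>_. 1)"
    using ellipse_coords[OF \<gamma>(1) assms(2)] by simp
  ultimately have "2 * (xc Q / a) * ((v \<bullet> e) / a) + 2 * (yc Q / ?b) * ((v \<bullet> e') / ?b) = 0"
    using DERIV_unique[OF _ DERIV_const] by simp
  then show ?thesis by linarith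
qed

end

section \<open>The ellipse in scaled coordinates and its Joachimsthal integral\<close>

locale ellipse_frame = focal_frame +
  fixes a b :: real
  assumes f_less: "f < a" and b_def: "b = sqrt (a\<^sup>2 - f\<^sup>2)"
begin

text \<open>On the ellipse, \<open>cc\<close> and \<open>sc\<close> are the cosine and sine of the
  eccentric angle.\<close>

definition cc :: "real^2 \<Rightarrow> real" where "cc X = xc X / a"
definition sc :: "real^2 \<Rightarrow> real" where "sc X = yc X / b"

lemma semiaxes: "0 < b" "b \<le> a" "0 < a" "b\<^sup>2 = a\<^sup>2 - f\<^sup>2"
proof -
  have "f\<^sup>2 < a\<^sup>2" using f_less f_nonneg by (intro power_strict_mono) auto
  then show "0 < b" and b2: "b\<^sup>2 = a\<^sup>2 - f\<^sup>2" by (simp_all add: b_def)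
  show a: "0 < a" using f_less f_nonneg by simp
  have "b\<^sup>2 \<le> a\<^sup>2" unfolding b2 by simp
  then show "b \<le> a" by (rule power2_le_imp_le) (use a in simp)
qed

lemma xc_eq: "xc X = a * cc X" and yc_eq: "yc X = b * sc X"
  using semiaxes by (simp_all add: cc_def sc_def)

lemma circle: "X \<in> ellipse F G a \<Longrightarrow> (cc X)\<^sup>2 + (sc X)\<^sup>2 = 1"
  using ellipse_coords[OF _ f_less, folded b_def] by (simp add: cc_def sc_def)

lemma scaled_coords_eqI: "cc X = cc Y \<Longrightarrow> sc X = sc Y \<Longrightarrow> X = Y"
  by (rule coords_eqI) (simp_all add: xc_eq yc_eq)

text \<open>The quotient \<open>h X Y / E X Y\<close> is the square of the Joachimsthal integral of the chord \<open>XY\<close>: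
  the integral is \<open>h X Y / dist X Y\<close>, and \<open>(dist X Y)\<^sup>2 = h X Y * E X Y\<close>.\<close>

definition h :: "real^2 \<Rightarrow> real^2 \<Rightarrow> real" where "h X Y = 1 - cc X * cc Y - sc X * sc Y"
definition E :: "real^2 \<Rightarrow> real^2 \<Rightarrow> real"
  where "E X Y = a\<^sup>2 + b\<^sup>2 - (a\<^sup>2 - b\<^sup>2) * (cc X * cc Y - sc X * sc Y)"

lemma dist_factor:
  assumes "X \<in> ellipse F G a" "Y \<in> ellipse F G a"
  shows "(dist X Y)\<^sup>2 = h X Y * E X Y"
  using chord_length_factor[OF circle circle, OF assms, of "a\<^sup>2" "b\<^sup>2"]
  by (simp add: dist_coords xc_eq yc_eq h_def E_def power_mult_distrib flip: right_diff_distrib)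

lemma h_E_pos:
  assumes "X \<in> ellipse F G a" "Y \<in> ellipse F G a" "X \<noteq> Y"
  shows "0 < h X Y" "0 < E X Y"
proof -
  have "2 * h X Y = (cc X - cc Y)\<^sup>2 + (sc X - sc Y)\<^sup>2"
    using circle[OF assms(1)] circle[OF assms(2)] unfolding h_def by algebra
  then have "h X Y \<ge> 0" by (smt (verit) zero_le_power2)
  moreover have "h X Y * E X Y > 0" using dist_factor[OF assms(1,2)] assms(3) by (metis zero_less_dist_iff zero_less_power)
  ultimately show "0 < h X Y" "0 < E X Y" by (auto simp: zero_less_mult_iff)
qed

text \<open>By the reflection law both sides at \<open>Y\<close> have the same squared cosine with
  the tangent. By \<open>chord_tangent_component\<close> and \<open>dist_factor\<close>, this
  squared cosine depends on the other endpoint only through \<open>h / E\<close>. If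
  \<open>X = Z\<close>, the tangential component equals its own negative and vanishes.\<close>

lemma reflection_relation:
  assumes on: "X \<in> ellipse F G a" "Y \<in> ellipse F G a" "Z \<in> ellipse F G a"
    and ne: "X \<noteq> Y" "Y \<noteq> Z"
    and refl: "reflection_law (ellipse F G a) X Y Z"
  shows reflection_invariant: "h X Y / E X Y = h Y Z / E Y Z"
    and reflection_normal: "X = Z \<Longrightarrow> a\<^sup>2 * (cc X - cc Y) * sc Y = b\<^sup>2 * (sc X - sc Y) * cc Y"
proof -
  obtain v where v: "tangent_vector (ellipse F G a) Y v" "vangle (X - Y) v = vangle (Z - Y) (- v)"
    using refl unfolding reflection_law_def by blast
  have v0: "v \<noteq> 0" using v(1) unfolding tangent_vector_def by blast
  have arg: "\<bar>(u \<bullet> w) / (norm u * norm w)\<bar> \<le> 1" for u w :: "real^2"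
    using Cauchy_Schwarz_ineq2[of u w] by (simp add: abs_mult divide_le_eq)
  have "((X - Y) \<bullet> v) / (norm (X - Y) * norm v) = ((Z - Y) \<bullet> (- v)) / (norm (Z - Y) * norm (- v))"
    using v(2) unfolding vangle_def by (subst (asm) arccos_eq_iff) (use arg in blast)+
  then have ang: "((X - Y) \<bullet> v) * dist Z Y = - ((Z - Y) \<bullet> v) * dist X Y"
    using v0 ne by (simp add: dist_norm field_simps)
  have "cc Y * ((v \<bullet> e) / a) + sc Y * ((v \<bullet> e') / b) = 0"
    using ellipse_tangent_vector[OF v(1) f_less, folded b_def] by (simp add: cc_def sc_def)
  \<comment> \<open>The tangent vector \<open>v\<close> is \<open>r\<close> times the standard one,
    \<open>(- a * sc Y, b * cc Y)\<close>; \<open>\<tau> U\<close> below is the inner product of the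
    chord from \<open>Y\<close> to \<open>U\<close> with the latter.\<close>
  moreover define r where "r = cc Y * ((v \<bullet> e') / b) - sc Y * ((v \<bullet> e) / a)"
  moreover note circle[OF on(2)]
  ultimately have "(v \<bullet> e) / a = - sc Y * r" "(v \<bullet> e') / b = cc Y * r" by algebra+
  then have ve: "v \<bullet> e = - a * sc Y * r" "v \<bullet> e' = b * cc Y * r" using semiaxes by (simp_all add: field_simps)
  have "r \<noteq> 0" using ve v0 frame_expansion[of v] by auto
  define \<tau> where "\<tau> U = a * (cc U - cc Y) * (- a * sc Y) + b * (sc U - sc Y) * (b * cc Y)" for U
  have inner: "(U - Y) \<bullet> v = r * \<tau> U" for U
    by (subst inner_frame) (simp add: ve xc_eq yc_eq \<tau>_def, simp add: algebra_simps)
  from ang have eq: "\<tau> X * dist Z Y = - \<tau> Z * dist X Y"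
  proof -
    have "r * (\<tau> X * dist Z Y) = r * (- \<tau> Z * dist X Y)" using ang unfolding inner by (simp add: algebra_simps)
    then show ?thesis using \<open>r \<noteq> 0\<close> by (metis mult_left_cancel)
  qed
  show "a\<^sup>2 * (cc X - cc Y) * sc Y = b\<^sup>2 * (sc X - sc Y) * cc Y" if "X = Z"
  proof -
    have "\<tau> X * dist X Y = 0" using eq \<open>X = Z\<close> by simp
    then have "\<tau> X = 0" using ne by simp
    then show ?thesis unfolding \<tau>_def by (simp add: algebra_simps power2_eq_square)
  qed
  have \<tau>2: "(\<tau> U)\<^sup>2 = h Y U * E Y U * (a\<^sup>2 * (sc Y)\<^sup>2 + b\<^sup>2 * (cc Y)\<^sup>2) - a\<^sup>2 * b\<^sup>2 * (h Y U)\<^sup>2"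
    if "U \<in> ellipse F G a" for U
    using chord_tangent_component[OF circle circle, OF on(2) that, of a b]
      chord_length_factor[OF circle circle, OF on(2) that, of "a\<^sup>2" "b\<^sup>2"]
    unfolding \<tau>_def h_def E_def by simp
  have pX: "0 < h Y X" "0 < E Y X" using h_E_pos on ne by blast+
  have pZ: "0 < h Y Z" "0 < E Y Z" using h_E_pos on ne by blast+
  have "(\<tau> X)\<^sup>2 * (dist Y Z)\<^sup>2 = (\<tau> Z)\<^sup>2 * (dist Y X)\<^sup>2"
  proof -
    have "(\<tau> X * dist Z Y)\<^sup>2 = (- \<tau> Z * dist X Y)\<^sup>2" using eq by simp
    then show ?thesis by (simp add: power_mult_distrib dist_commute)
  qed
  \<comment> \<open>The terms containing the squared length of the tangent vector cancel.\<close>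
  then have "a\<^sup>2 * b\<^sup>2 * h Y X * h Y Z * (h Y X * E Y Z - h Y Z * E Y X) = 0"
    unfolding dist_factor[OF on(2,3)] dist_factor[OF on(2,1)] \<tau>2[OF on(1)] \<tau>2[OF on(3)]
    by (simp add: algebra_simps power2_eq_square) auto
  then have "h Y X * E Y Z = h Y Z * E Y X" using semiaxes(1,3) pX(1) pZ(1) by (simp add: mult.commute)
  moreover have "h Y X = h X Y" "E Y X = E X Y" by (simp_all add: h_def E_def mult.commute)
  ultimately show "h X Y / E X Y = h Y Z / E Y Z" using pX pZ by (simp add: frac_eq_eq)
qed

end

section \<open>Tangents of the confocal hyperbola\<close>

context focal_frame
begin

lemma hyperbola_coordsI:
  assumes pq: "0 < p" "0 < q" "p + q = f\<^sup>2" and xy: "x\<^sup>2 / p - y\<^sup>2 / q = 1"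
  shows "pt x y \<in> hyperbola F G (sqrt p)"
proof -
  define c where "c = sqrt p"
  have c: "0 < c" "c\<^sup>2 = p" using pq by (simp_all add: c_def)
  have cf: "c \<le> f" using pq c f_nonneg by (intro power2_le_imp_le[of c f]) auto
  \<comment> \<open>The focal distances are \<open>\<bar>r - c\<bar>\<close> and
    \<open>\<bar>r + c\<bar>\<close>; they differ by \<open>2 * c\<close> because
    \<open>c \<le> \<bar>x\<bar>\<close> and \<open>c \<le> f\<close> give
    \<open>c \<le> \<bar>r\<bar>\<close>.\<close>
  define r where "r = f * x / c"
  have r: "r * c = f * x" using c by (simp add: r_def)
  have hyp: "x\<^sup>2 * q - y\<^sup>2 * p = p * q" using xy pq by (simp add: field_simps)
  have "p * ((x - f)\<^sup>2 + y\<^sup>2 - (r - c)\<^sup>2) = 0" "p * ((x + f)\<^sup>2 + y\<^sup>2 - (r + c)\<^sup>2) = 0"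
    using hyp r c(2) pq(3) by algebra+
  then have d: "(dist (pt x y) F)\<^sup>2 = (r - c)\<^sup>2" "(dist (pt x y) G)\<^sup>2 = (r + c)\<^sup>2"
    using pq(1) by (simp_all add: dist_coords foci_coords)
  have dF: "dist (pt x y) F = \<bar>r - c\<bar>" and dG: "dist (pt x y) G = \<bar>r + c\<bar>"
    using arg_cong[OF d(1), of sqrt] arg_cong[OF d(2), of sqrt] by simp_all
  have "p * q \<le> x\<^sup>2 * q" using hyp pq(1) by (smt (verit) mult_nonneg_nonneg zero_le_power2)
  then have "c\<^sup>2 \<le> x\<^sup>2" using pq(2) c(2) by simp
  then have "c \<le> \<bar>x\<bar>" using c(1) by (simp add: abs_le_square_iff[symmetric])
  then have "c * c \<le> f * \<bar>x\<bar>" using cf c(1) by (intro mult_mono) auto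
  also have "\<dots> = \<bar>r * c\<bar>" using r f_nonneg by (simp add: abs_mult)
  finally have "c \<le> \<bar>r\<bar>" using c(1) by (simp add: abs_mult)
  then have "\<bar>\<bar>r - c\<bar> - \<bar>r + c\<bar>\<bar> = 2 * c" using c(1) by linarith
  then show ?thesis by (simp add: hyperbola_def dF dG c_def)
qed

lemma continuous_on_pt:
  "continuous_on S g \<Longrightarrow> continuous_on S k \<Longrightarrow> continuous_on S (\<lambda>t. pt (g t) (k t))"
  unfolding pt_def by (intro continuous_intros)

lemma has_vector_derivative_pt:
  assumes "(g has_real_derivative g') (at t)" "(k has_real_derivative k') (at t)"
  shows "((\<lambda>t. pt (g t) (k t)) has_vector_derivative g' *\<^sub>R e + k' *\<^sub>R e') (at t)"
proof -
  have "((\<lambda>t. g t *\<^sub>R u) has_vector_derivative g' *\<^sub>R u) (at t)"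
    if "(g has_real_derivative g') (at t)" for g g' and u :: "real^2"
    using bounded_linear.has_vector_derivative[OF bounded_linear_scaleR_left] that
    by (simp add: has_real_derivative_iff_has_vector_derivative)
  note D = this[OF assms(1), of e] this[OF assms(2), of e']
  show ?thesis
    using has_vector_derivative_add[OF has_vector_derivative_add[OF has_vector_derivative_const D(1)] D(2)]
    unfolding pt_def by simp
qed

lemma direction_nonzero: "m *\<^sub>R e + e' \<noteq> 0"
proof
  assume "m *\<^sub>R e + e' = 0"
  then have "(m *\<^sub>R e + e') \<bullet> e' = 0" by simp
  then show False using orthonormal by (simp add: inner_simps)
qed

lemma line_through_pt:
  "line_through (pt (m * y0 + d) y0) (m *\<^sub>R e + e') = range (\<lambda>y. pt (m * y + d) y)"
proof -
  have "pt (m * y0 + d) y0 + s *\<^sub>R (m *\<^sub>R e + e') = pt (m * (y0 + s) + d) (y0 + s)" for s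
    by (simp add: pt_def algebra_simps)
  moreover have "range (\<lambda>s. pt (m * (y0 + s) + d) (y0 + s)) = range (\<lambda>y. pt (m * y + d) y)"
    using image_image[of "\<lambda>y. pt (m * y + d) y" "\<lambda>s. y0 + s" UNIV] by simp
  ultimately show ?thesis by (simp add: line_through_def)
qed

text \<open>Substituting \<open>x = m * y + d\<close> into the equation of the hyperbola gives a
  quadratic in \<open>y\<close> whose discriminant vanishes under the assumption on
  \<open>d\<close>. For \<open>d = 0\<close> its leading coefficient vanishes too, and contact is at
  infinity.\<close>

lemma hyperbola_tangent_line:
  assumes pq: "0 < p" "0 < q" "p + q = f\<^sup>2" and d: "d\<^sup>2 = p - m\<^sup>2 * q"
  shows "tangent_line (hyperbola F G (sqrt p)) (range (\<lambda>y. pt (m * y + d) y))"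
proof (cases "d = 0")
  case False
  \<comment> \<open>\<open>y0\<close> is the ordinate of the point of contact.\<close>
  define y0 where "y0 = q * m / d"
  \<comment> \<open>The branch is parametrised by its ordinate; \<open>sgn d\<close> selects the one
    containing the point of contact, whose abscissa is \<open>p / d\<close>.\<close>
  define g where "g t = sgn d * sqrt (p + p / q * (y0 + t)\<^sup>2)" for t
  define \<gamma> where "\<gamma> t = pt (g t) (y0 + t)" for t
  have pos: "p + p / q * (y0 + t)\<^sup>2 > 0" for t using pq by (simp add: add_pos_nonneg)
  have on: "\<gamma> t \<in> hyperbola F G (sqrt p)" for t
    unfolding \<gamma>_def
  proof (rule hyperbola_coordsI[OF pq])
    have "(g t)\<^sup>2 = p + p / q * (y0 + t)\<^sup>2"
      using pos[of t] False by (simp add: g_def power_mult_distrib sgn_if)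
    then show "(g t)\<^sup>2 / p - (y0 + t)\<^sup>2 / q = 1" using pq by (simp add: field_simps)
  qed
  have cont: "continuous_on UNIV \<gamma>"
    unfolding \<gamma>_def g_def by (intro continuous_on_pt continuous_intros)
  have root: "sqrt (p + p / q * y0\<^sup>2) = p / \<bar>d\<bar>"
  proof -
    have "d\<^sup>2 * (p + p / q * y0\<^sup>2) = p * (d\<^sup>2 + q * m\<^sup>2)"
      using False pq by (simp add: y0_def field_simps power2_eq_square)
    also have "\<dots> = p\<^sup>2" using d by algebra
    finally have "p + p / q * y0\<^sup>2 = (p / \<bar>d\<bar>)\<^sup>2" using False by (simp add: field_simps power_divide)
    then show ?thesis using pq by simp
  qed
  have "g 0 = sgn d * (p / \<bar>d\<bar>)" by (simp only: g_def root add_0_right)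
  then have g0: "g 0 = p / d" by (simp add: sgn_if)
  have "p / d = m * y0 + d"
    using False d by (simp add: y0_def field_simps power2_eq_square)
  then have \<gamma>0: "\<gamma> 0 = pt (m * y0 + d) y0" by (simp add: \<gamma>_def g0)
  have g': "(g has_real_derivative m) (at 0)"
  proof -
    have "(g has_real_derivative sgn d * (p / q * (2 * y0)) * (inverse (sqrt (p + p / q * y0\<^sup>2)) / 2)) (at 0)"
      unfolding g_def using pos[of 0] pq by (auto intro!: derivative_eq_intros)
    moreover have "sgn d * (p / q * (2 * y0)) * (inverse (sqrt (p + p / q * y0\<^sup>2)) / 2) = m"
    proof -
      have "y0 / q = m / d" using pq(2) by (simp add: y0_def)
      then have "p / q * (2 * y0) = 2 * p * (m / d)" by (metis times_divide_eq_right times_divide_eq_left mult.assoc mult.commute)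
      then show ?thesis unfolding root using False pq(1) by (simp add: sgn_if)
    qed
    ultimately show ?thesis by simp
  qed
  have y': "((\<lambda>t. y0 + t) has_real_derivative 1) (at 0)"
    by (auto intro!: derivative_eq_intros)
  have der: "(\<gamma> has_vector_derivative m *\<^sub>R e + e') (at 0)"
    using has_vector_derivative_pt[OF g' y'] unfolding \<gamma>_def by simp
  have "tangent_vector (hyperbola F G (sqrt p)) (pt (m * y0 + d) y0) (m *\<^sub>R e + e')"
    unfolding tangent_vector_def
    by (intro conjI direction_nonzero exI[of _ \<gamma>] allI on cont \<gamma>0 der)
  then show ?thesis unfolding tangent_line_def line_through_pt[symmetric, of _ _ y0] by blast
next
  case True
  \<comment> \<open>A line through the centre is an asymptote.\<close>
  define L where "L = range (\<lambda>y. pt (m * y) y)"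
  \<comment> \<open>Since \<open>p = m\<^sup>2 * q\<close>, this is a whole branch, parametrised by
    its ordinate.\<close>
  define \<gamma> where "\<gamma> t = pt (m * sqrt (q + t\<^sup>2)) t" for t
  have pos: "q + t\<^sup>2 > 0" for t using pq by (simp add: add_pos_nonneg)
  have p: "p = m\<^sup>2 * q" using d True by simp
  then have m0: "m \<noteq> 0" using pq(1) by auto
  have "\<gamma> t \<in> hyperbola F G (sqrt p)" for t
    unfolding \<gamma>_def
  proof (rule hyperbola_coordsI[OF pq])
    have m2: "(m * sqrt (q + t\<^sup>2))\<^sup>2 = m\<^sup>2 * (q + t\<^sup>2)" using pos[of t] by (simp add: power_mult_distrib)
    have "(m * sqrt (q + t\<^sup>2))\<^sup>2 / p = (q + t\<^sup>2) / q" unfolding m2 using p m0 by simp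
    also have "\<dots> = 1 + t\<^sup>2 / q" using pq(2) by (simp add: add_divide_distrib)
    finally show "(m * sqrt (q + t\<^sup>2))\<^sup>2 / p - t\<^sup>2 / q = 1" by simp
  qed
  moreover have "continuous_on UNIV \<gamma>"
    unfolding \<gamma>_def by (intro continuous_on_pt continuous_intros)
  moreover have "filterlim \<gamma> at_infinity at_top"
  proof -
    have "t - norm (midpoint F G) \<le> norm (\<gamma> t)" for t
    proof -
      have "t = (\<gamma> t - midpoint F G) \<bullet> e'" using yc_pt by (simp only: \<gamma>_def yc_def)
      also have "\<dots> \<le> norm (\<gamma> t - midpoint F G) * norm e'" by (rule norm_cauchy_schwarz)
      also have "\<dots> = norm (\<gamma> t - midpoint F G)" using orthonormal by (simp add: norm_eq_1)
      also have "\<dots> \<le> norm (\<gamma> t) + norm (midpoint F G)" by (rule norm_triangle_ineq4)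
      finally show ?thesis by simp
    qed
    then have "\<forall>\<^sub>F t in at_top. t - norm (midpoint F G) \<le> norm (\<gamma> t)"
      by (intro always_eventually allI)
    moreover have "filterlim (\<lambda>t. t - norm (midpoint F G)) at_top at_top" by real_asymp
    ultimately have "filterlim (\<lambda>t. norm (\<gamma> t)) at_top at_top"
      by (rule filterlim_at_top_mono[rotated])
    then show ?thesis unfolding filterlim_at_infinity_conv_norm_at_top .
  qed
  moreover have "((\<lambda>t. infdist (\<gamma> t) L) \<longlongrightarrow> 0) at_top"
  proof (rule tendsto_sandwich[of "\<lambda>_. 0"])
    \<comment> \<open>The curve is compared with the point of \<open>L\<close> at the same
      ordinate.\<close>
    have "infdist (\<gamma> t) L \<le> \<bar>m\<bar> * \<bar>sqrt (q + t\<^sup>2) - t\<bar>" for t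
    proof -
      have "infdist (\<gamma> t) L \<le> dist (\<gamma> t) (pt (m * t) t)" by (rule infdist_le) (simp add: L_def)
      also have "(dist (\<gamma> t) (pt (m * t) t))\<^sup>2 = (m * (sqrt (q + t\<^sup>2) - t))\<^sup>2"
        by (simp add: dist_coords \<gamma>_def algebra_simps)
      then have "dist (\<gamma> t) (pt (m * t) t) = \<bar>m * (sqrt (q + t\<^sup>2) - t)\<bar>"
        by (metis abs_of_nonneg real_sqrt_abs zero_le_dist)
      finally show ?thesis by (simp add: abs_mult)
    qed
    then show "\<forall>\<^sub>F t in at_top. infdist (\<gamma> t) L \<le> \<bar>m\<bar> * \<bar>sqrt (q + t\<^sup>2) - t\<bar>" by simp
    have "((\<lambda>t. sqrt (q + t\<^sup>2) - t) \<longlongrightarrow> 0) at_top" by real_asymp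
    then show "((\<lambda>t. \<bar>m\<bar> * \<bar>sqrt (q + t\<^sup>2) - t\<bar>) \<longlongrightarrow> 0) at_top"
      by (intro tendsto_mult_right_zero tendsto_rabs_zero)
  qed (auto simp: infdist_nonneg)
  moreover have "L = line_through (pt (m * 0 + 0) 0) (m *\<^sub>R e + e')"
    unfolding line_through_pt by (simp add: L_def)
  ultimately have "asymptote (hyperbola F G (sqrt p)) L"
    unfolding asymptote_def using direction_nonzero[of m] by blast
  then show ?thesis unfolding tangent_line_def L_def using True by simp
qed

section \<open>Segments and symmetric quadrilaterals in coordinates\<close>

lemma xc_affine: "xc ((1 - u) *\<^sub>R X + u *\<^sub>R Y) = (1 - u) * xc X + u * xc Y"
  and yc_affine: "yc ((1 - u) *\<^sub>R X + u *\<^sub>R Y) = (1 - u) * yc X + u * yc Y"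
  by (simp_all add: xc_def yc_def inner_simps algebra_simps)

lemma closed_segment_coords:
  assumes "Z \<in> closed_segment X Y"
  obtains u where "0 \<le> u" "u \<le> 1" "xc Z = (1 - u) * xc X + u * xc Y" "yc Z = (1 - u) * yc X + u * yc Y"
proof -
  obtain u where "0 \<le> u" "u \<le> 1" "Z = (1 - u) *\<^sub>R X + u *\<^sub>R Y"
    using assms unfolding closed_segment_def by blast
  then show thesis using that[of u] xc_affine yc_affine by blast
qed

text \<open>The segment from \<open>X\<close> to \<open>Y\<close> meets the axis
  \<open>xc = 0\<close>, and the point where it does is fixed by the reflection that carries this
  segment to the other one.\<close>

lemma symmetric_segments_meet:
  assumes "xc Z = - xc X" "yc Z = yc X" "xc W = - xc Y" "yc W = yc Y" "xc X * xc Y \<le> 0"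
  shows "closed_segment X Y \<inter> closed_segment Z W \<noteq> {}"
proof -
  have "\<exists>u. 0 \<le> u \<and> u \<le> 1 \<and> (1 - u) * xc X + u * xc Y = 0"
  proof (cases "xc X = xc Y")
    case True
    then show ?thesis using assms(5) by (intro exI[of _ 0]) (auto simp: mult_le_0_iff)
  next
    case False
    then show ?thesis using assms(5)
      by (intro exI[of _ "xc X / (xc X - xc Y)"])
        (auto simp: divide_simps mult_le_0_iff algebra_simps)
  qed
  then obtain u where u: "0 \<le> u" "u \<le> 1" "(1 - u) * xc X + u * xc Y = 0" by blast
  have "(1 - u) * xc Z + u * xc W = 0" unfolding assms(1,3) using u(3) by algebra
  then have "(1 - u) *\<^sub>R X + u *\<^sub>R Y = (1 - u) *\<^sub>R Z + u *\<^sub>R W"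
    by (intro coords_eqI) (simp_all add: xc_affine yc_affine u(3) assms(2,4))
  then show ?thesis using u unfolding closed_segment_def by blast
qed

lemma antipodal_side_disjoint:
  assumes "xc Z = - xc X" "yc Z = - yc X" "xc W = - xc Y" "yc W = - yc Y"
    and "xc X * yc Y \<noteq> xc Y * yc X"
  shows "closed_segment Z W \<inter> affine hull {X, Y} = {}"
proof -
  have False if Q: "Q \<in> closed_segment Z W" "Q \<in> affine hull {X, Y}" for Q
  proof -
    obtain t where t: "xc Q = (1 - t) * xc Z + t * xc W" "yc Q = (1 - t) * yc Z + t * yc W"
      using closed_segment_coords[OF Q(1)] by blast
    obtain u v where uv: "u + v = 1" "Q = u *\<^sub>R X + v *\<^sub>R Y" using Q(2) unfolding affine_hull_2 by blast
    then have u: "u = 1 - v" by simp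
    have Qc: "xc Q = (1 - v) * xc X + v * xc Y" "yc Q = (1 - v) * yc X + v * yc Y"
      unfolding uv(2) u by (rule xc_affine yc_affine)+
    \<comment> \<open>A linear form that is constant on the line \<open>XY\<close>, with value
      \<open>xc X * yc Y - xc Y * yc X\<close>, takes the opposite value on \<open>ZW\<close>; at a
      common point \<open>Q\<close> the two values agree.\<close>
    have "2 * (xc X * yc Y - xc Y * yc X) = 0"
      using t Qc unfolding assms(1-4) by algebra
    then show False using assms(5) by simp
  qed
  then show ?thesis by blast
qed

lemma parallelogram_convex:
  assumes "xc Z = - xc X" "yc Z = - yc X" "xc W = - xc Y" "yc W = - yc Y"
    and "xc X * yc Y \<noteq> xc Y * yc X"
  shows "convex_quadrilateral X Y Z W"
  unfolding convex_quadrilateral_def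
  by (intro conjI antipodal_side_disjoint) (use assms in \<open>auto simp: algebra_simps\<close>)

end

section \<open>Sides touching the confocal hyperbola\<close>

context ellipse_frame
begin

lemma side_tangent:
  assumes on: "X \<in> ellipse F G a" "Y \<in> ellipse F G a"
    and ab: "2 * b\<^sup>2 < a\<^sup>2" and prod: "sc X * sc Y = - b\<^sup>2 / (a\<^sup>2 - b\<^sup>2)"
  shows "\<exists>L. tangent_line (hyperbola F G (sqrt (a\<^sup>2 * (a\<^sup>2 - 2 * b\<^sup>2) / (a\<^sup>2 - b\<^sup>2)))) L
    \<and> closed_segment X Y \<subseteq> L"
proof -
  define D where "D = a\<^sup>2 - b\<^sup>2"
  define p where "p = a\<^sup>2 * (a\<^sup>2 - 2 * b\<^sup>2) / D"
  define q where "q = b\<^sup>2 * b\<^sup>2 / D"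
  have bpos: "0 < b\<^sup>2" "0 < a\<^sup>2" using semiaxes(1,3) by simp_all
  have D: "0 < D" using ab bpos unfolding D_def by linarith
  have pq: "0 < p" "0 < q" using D bpos ab unfolding p_def q_def by (intro divide_pos_pos mult_pos_pos; linarith)+
  have Dp: "D * p = a\<^sup>2 * (a\<^sup>2 - 2 * b\<^sup>2)" and Dq: "D * q = b\<^sup>2 * b\<^sup>2"
    using D by (simp_all add: p_def q_def)
  have "D * (p + q) = D * D" using Dp Dq D_def by algebra
  then have "p + q = D" using D by simp
  then have sum: "p + q = f\<^sup>2" using semiaxes(4) by (simp add: D_def)
  have ss: "D * (sc X * sc Y) = - b\<^sup>2" using prod D by (simp add: D_def)
  have "D * (yc X * yc Y + q) = 0" using ss Dq unfolding yc_eq by algebra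
  then have yy: "yc X * yc Y = - q" using D by simp
  \<comment> \<open>The ordinates have opposite signs, so the side is not horizontal and its line
    has the form \<open>x = m * y + d\<close>.\<close>
  have ne: "yc Y - yc X \<noteq> 0"
  proof
    assume "yc Y - yc X = 0"
    then have "yc X * yc X = - q" using yy by simp
    then show False using pq(2) zero_le_square[of "yc X"] by linarith
  qed
  \<comment> \<open>This is the tangency condition \<open>d\<^sup>2 = p - m\<^sup>2 * q\<close>
    multiplied by \<open>(yc Y - yc X)\<^sup>2\<close>.\<close>
  have key: "p * (yc Y - yc X)\<^sup>2 - q * (xc Y - xc X)\<^sup>2 = (xc X * yc Y - xc Y * yc X)\<^sup>2"
  proof -
    have "D * (p * (yc Y - yc X)\<^sup>2 - q * (xc Y - xc X)\<^sup>2 - (xc X * yc Y - xc Y * yc X)\<^sup>2) = 0"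
      using circle[OF on(1)] circle[OF on(2)] ss Dp Dq D_def unfolding xc_eq yc_eq by algebra
    then show ?thesis using D by simp
  qed
  define m where "m = (xc Y - xc X) / (yc Y - yc X)"
  define d where "d = xc X - m * yc X"
  have m: "m * (yc Y - yc X) = xc Y - xc X" using ne by (simp add: m_def)
  have "(yc Y - yc X)\<^sup>2 * (d\<^sup>2 - (p - m\<^sup>2 * q)) = 0"
    using key m d_def by algebra
  then have "d\<^sup>2 = p - m\<^sup>2 * q" using ne by simp
  note tan = hyperbola_tangent_line[OF pq sum this]
  have "closed_segment X Y \<subseteq> range (\<lambda>y. pt (m * y + d) y)"
  proof
    fix Z assume "Z \<in> closed_segment X Y"
    then obtain u where u: "xc Z = (1 - u) * xc X + u * xc Y" "yc Z = (1 - u) * yc X + u * yc Y"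
      using closed_segment_coords by blast
    have "xc Z = m * yc Z + d" using u m d_def by algebra
    then have "Z = pt (m * yc Z + d) (yc Z)" by (metis pt_coords)
    then show "Z \<in> range (\<lambda>y. pt (m * y + d) y)" by blast
  qed
  then show ?thesis using tan unfolding p_def D_def by blast
qed

section \<open>Trajectories of period four\<close>

lemma parallelogram_in_ellipse_convex:
  assumes on: "X \<in> ellipse F G a" "Y \<in> ellipse F G a" and "X \<noteq> Y" "Y \<noteq> Z"
    and eq: "cc Z = - cc X" "sc Z = - sc X" "cc W = - cc Y" "sc W = - sc Y"
  shows "convex_quadrilateral X Y Z W"
proof (rule parallelogram_convex)
  \<comment> \<open>If \<open>X\<close> and \<open>Y\<close> were collinear with the centre, they
    would be antipodal, which would give \<open>Y = Z\<close>.\<close>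
  have "cc X * sc Y \<noteq> cc Y * sc X"
  proof
    assume par: "cc X * sc Y = cc Y * sc X"
    have "(cc X, sc X) \<noteq> (cc Y, sc Y)" using assms(3) scaled_coords_eqI[of X Y] by blast
    then have "cc X = - cc Y \<and> sc X = - sc Y"
      by (rule unit_parallel[OF circle[OF on(1)] circle[OF on(2)] par])
    then have "cc Y = cc Z" "sc Y = sc Z" unfolding eq by linarith+
    then show False using assms(4) scaled_coords_eqI by blast
  qed
  then show "xc X * yc Y \<noteq> xc Y * yc X" using semiaxes(1,3) by (simp add: xc_eq yc_eq algebra_simps)
qed (simp_all add: xc_eq yc_eq eq)

text \<open>Reflection in the minor axis exchanges opposite sides. If \<open>X\<close> and
  \<open>Y\<close> do not lie strictly on the same side of that axis, \<open>XY\<close> meets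
  \<open>ZW\<close>; otherwise \<open>Y\<close> and \<open>Z\<close> are separated by it and
  \<open>YZ\<close> meets \<open>WX\<close>.\<close>

lemma symmetric_butterfly:
  assumes eq: "cc Z = - cc X" "sc Z = sc X" "cc W = - cc Y" "sc W = sc Y"
    and ne: "X \<noteq> Y" "Y \<noteq> Z" "Z \<noteq> W" "W \<noteq> X"
  shows "darboux_butterfly X Y Z W"
proof -
  have co: "xc Z = - xc X" "yc Z = yc X" "xc W = - xc Y" "yc W = yc Y"
    by (simp_all add: xc_eq yc_eq eq)
  have "(dist X Y)\<^sup>2 = (dist Z W)\<^sup>2" "(dist X W)\<^sup>2 = (dist Y Z)\<^sup>2"
    unfolding dist_coords co by algebra+
  then have "dist X Y = dist Z W" "dist X W = dist Y Z" by simp_all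
  moreover have "closed_segment X Y \<inter> closed_segment Z W \<noteq> {} \<or>
      closed_segment Y Z \<inter> closed_segment W X \<noteq> {}"
  proof (cases "xc X * xc Y \<le> 0")
    case True
    then show ?thesis using symmetric_segments_meet co by blast
  next
    case False
    then have "xc Y * xc Z \<le> 0" by (simp add: co mult.commute)
    then show ?thesis using symmetric_segments_meet[of W Y X Z] co by simp
  qed
  ultimately show ?thesis using ne unfolding darboux_butterfly_def by blast
qed

lemma nonconvex_trajectory_shape:
  assumes traj: "billiard_trajectory (ellipse F G a) P" and per: "periodic_trajectory 4 P"
    and nonconvex: "\<not> convex_quadrilateral (P 0) (P 1) (P 2) (P 3)"
  shows "2 * b\<^sup>2 < a\<^sup>2 \<and> cc (P 2) = - cc (P 0) \<and> sc (P 2) = sc (P 0) \<and>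
    cc (P 3) = - cc (P 1) \<and> sc (P 3) = sc (P 1) \<and> sc (P 0) * sc (P 1) = - b\<^sup>2 / (a\<^sup>2 - b\<^sup>2)"
proof -
  have on: "P i \<in> ellipse F G a" and ne: "P i \<noteq> P (Suc i)"
    and refl: "reflection_law (ellipse F G a) (P i) (P (Suc i)) (P (Suc (Suc i)))" for i
    using traj unfolding billiard_trajectory_def by blast+
  have P4: "P (i + 4) = P i" for i
    using per unfolding periodic_trajectory_def by blast
  have P45: "P 4 = P 0" "P 5 = P 1" using P4[of 0] P4[of 1] by simp_all
  \<comment> \<open>If both pairs of opposite vertices coincided, 2 would be a period.\<close>
  have proper: "P 0 \<noteq> P 2 \<or> P 1 \<noteq> P 3"
  proof (rule ccontr)
    assume "\<not> ?thesis"
    then have eq: "P 0 = P 2" "P 1 = P 3" by simp_all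
    have "P (i + 2) = P i" for i
    proof (induction i rule: less_induct)
      case (less i)
      consider "i = 0" | "i = 1" | j where "i = j + 2" by (metis One_nat_def add_2_eq_Suc' old.nat.exhaust)
      then show ?case
      proof cases
        case 3
        then have "P (i + 2) = P (j + 4)" by (simp add: numeral_eq_Suc)
        then show ?thesis using 3 P4[of j] less[of j] by simp
      next
        case 1
        then show ?thesis using eq by (simp add: numeral_eq_Suc)
      next
        case 2
        then show ?thesis using eq by (simp add: numeral_eq_Suc)
      qed
    qed
    then show False using per unfolding periodic_trajectory_def by (metis zero_less_numeral numeral_less_iff semiring_norm(75,76,78))
  qed
  define k where "k = h (P 0) (P 1) / E (P 0) (P 1)"
  have k_eq: "h (P i) (P (Suc i)) / E (P i) (P (Suc i)) = k" for i
  proof (induction i)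
    case 0
    then show ?case by (simp add: k_def)
  next
    case (Suc i)
    then show ?case using reflection_invariant[OF on on on ne ne refl] by simp
  qed
  have kpos: "k > 0" unfolding k_def using h_E_pos[OF on on ne[of 0]] by simp
  have rel: "1 - cc (P i) * cc (P (Suc i)) - sc (P i) * sc (P (Suc i))
      = k * (a\<^sup>2 + b\<^sup>2 - (a\<^sup>2 - b\<^sup>2) * (cc (P i) * cc (P (Suc i)) - sc (P i) * sc (P (Suc i))))" for i
    using k_eq[of i] h_E_pos(2)[OF on on ne[of i]] by (simp add: h_def E_def divide_eq_eq)
  have rel': "1 - cc (P (Suc i)) * cc (P i) - sc (P (Suc i)) * sc (P i)
      = k * (a\<^sup>2 + b\<^sup>2 - (a\<^sup>2 - b\<^sup>2) * (cc (P (Suc i)) * cc (P i) - sc (P (Suc i)) * sc (P i)))" for i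
    using rel[of i] by (simp add: mult.commute)
  note rels = rel[of 0] rel[of 1] rel[of 2] rel[of 3] rel'[of 0] rel'[of 1] rel'[of 2] rel'[of 3]
  have nums: "Suc 0 = 1" "Suc 1 = 2" "Suc 2 = 3" "Suc 3 = 4" "Suc 4 = 5" by simp_all
  note rels = rels[unfolded nums P45]
  have ne': "(cc (P i), sc (P i)) \<noteq> (cc (P j), sc (P j))" if "P i \<noteq> P j" for i j
    using that scaled_coords_eqI[of "P i" "P j"] by blast
  note nes = ne[of 0] ne[of 1] ne[of 2] ne[of 3]
  note nes = nes[unfolded nums P45]
  have normal: "a\<^sup>2 * (cc (P i) - cc (P (Suc i))) * sc (P (Suc i)) = b\<^sup>2 * (sc (P i) - sc (P (Suc i))) * cc (P (Suc i))"
    if "P i = P (Suc (Suc i))" for i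
    using reflection_normal[OF on on on ne ne refl that] .
  note normals = normal[of 0] normal[of 1] normal[of 2] normal[of 3]
  note normals = normals[unfolded nums P45]
  have b2: "0 < b\<^sup>2" "b\<^sup>2 \<le> a\<^sup>2" using semiaxes(1,2) by (auto intro: power_mono)
  have shape: "b\<^sup>2 < a\<^sup>2 \<and> cc (P 2) = - cc (P 0) \<and> sc (P 2) = sc (P 0) \<and>
    cc (P 3) = - cc (P 1) \<and> sc (P 3) = sc (P 1) \<and> sc (P 0) * sc (P 1) = - b\<^sup>2 / (a\<^sup>2 - b\<^sup>2)"
  proof -
    consider "P 0 \<noteq> P 2" "P 1 \<noteq> P 3" | "P 0 = P 2" "P 1 \<noteq> P 3" | "P 1 = P 3" "P 0 \<noteq> P 2"
      using proper by blast
    then show ?thesis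
    proof cases
      case 1
      have "1 - cc (P i) * cc (P j) - sc (P i) * sc (P j)
          = k * (a\<^sup>2 + b\<^sup>2 - (a\<^sup>2 - b\<^sup>2) * (cc (P i) * cc (P j) - sc (P i) * sc (P j)))"
        if "(i, j) \<in> {(0,1),(1,2),(2,3),(3,0)}" for i j
        using that rels by auto
      note symmetric_shape[of "b\<^sup>2" "a\<^sup>2" "\<lambda>i. cc (P i)" "\<lambda>i. sc (P i)", OF b2 circle[OF on] kpos this ne'[OF 1(1)] ne'[OF 1(2)]]
      \<comment> \<open>The antipodal alternative is a convex parallelogram.\<close>
      moreover have "\<not> (cc (P 2) = - cc (P 0) \<and> sc (P 2) = - sc (P 0) \<and> cc (P 3) = - cc (P 1) \<and> sc (P 3) = - sc (P 1))"
        using parallelogram_in_ellipse_convex[OF on on nes(1,2)] nonconvex by blast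
      ultimately show ?thesis by blast
    next
      case 2
      \<comment> \<open>The trajectory turns back at \<open>P 1\<close> and \<open>P 3\<close>,
        which are the feet of the two normal chords. In the next case these are \<open>P 0\<close>
        and \<open>P 2\<close>.\<close>
      have "b\<^sup>2 < a\<^sup>2 \<and> cc (P 0) = 0 \<and> cc (P 3) = - cc (P 1) \<and> sc (P 3) = sc (P 1) \<and>
          sc (P 0) * sc (P 1) = - b\<^sup>2 / (a\<^sup>2 - b\<^sup>2)"
        by (rule normal_shape[OF b2 circle[OF on] circle[OF on] circle[OF on] rels(1) rels(8)
              normals(1)[OF 2(1)] normals(3)[OF 2(1)[symmetric], folded 2(1)]
              ne'[OF nes(1)] ne'[OF nes(4)[symmetric]] ne'[OF 2(2)]])
      then show ?thesis using 2 by simp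
    next
      case 3
      have "b\<^sup>2 < a\<^sup>2 \<and> cc (P 1) = 0 \<and> cc (P 2) = - cc (P 0) \<and> sc (P 2) = sc (P 0) \<and>
          sc (P 1) * sc (P 0) = - b\<^sup>2 / (a\<^sup>2 - b\<^sup>2)"
        by (rule normal_shape[OF b2 circle[OF on] circle[OF on] circle[OF on] rels(5) rels(2)
              normals(4)[OF 3(1)[symmetric], folded 3(1)] normals(2)[OF 3(1)]
              ne'[OF nes(1)[symmetric]] ne'[OF nes(2)] ne'[OF 3(2)]])
      then show ?thesis using 3 by (simp add: mult.commute)
    qed
  qed
  \<comment> \<open>Otherwise the product of the two sines has absolute value at least 1, so all
    vertices are ends of the minor axis and opposite ones coincide.\<close>
  moreover have "2 * b\<^sup>2 < a\<^sup>2"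
  proof (rule ccontr)
    assume "\<not> ?thesis"
    then have "1 \<le> b\<^sup>2 / (a\<^sup>2 - b\<^sup>2)" using shape by (simp add: le_divide_eq)
    then have "1 \<le> \<bar>sc (P 0) * sc (P 1)\<bar>" using shape by simp
    then have *: "1 \<le> (sc (P 0))\<^sup>2 * (sc (P 1))\<^sup>2"
      by (metis one_le_power power2_abs power_mult_distrib)
    have le: "(sc (P i))\<^sup>2 \<le> 1" for i using circle[OF on, of i] zero_le_power2[of "cc (P i)"] by linarith
    have "(sc (P 0))\<^sup>2 * (sc (P 1))\<^sup>2 \<le> (sc (P 0))\<^sup>2 * 1" "(sc (P 0))\<^sup>2 * (sc (P 1))\<^sup>2 \<le> 1 * (sc (P 1))\<^sup>2"
      by (intro mult_mono le; simp)+
    then have "(sc (P 0))\<^sup>2 = 1" "(sc (P 1))\<^sup>2 = 1" using * le[of 0] le[of 1] by linarith+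
    then have "cc (P 0) = 0" "cc (P 1) = 0" using circle[OF on, of 0] circle[OF on, of 1] by simp_all
    then have "P 0 = P 2" "P 1 = P 3" using shape by (auto intro!: scaled_coords_eqI)
    then show False using proper by blast
  qed
  ultimately show ?thesis by blast
qed

lemma nonconvex_trajectory:
  assumes traj: "billiard_trajectory (ellipse F G a) P" and per: "periodic_trajectory 4 P"
    and nonconvex: "\<not> convex_quadrilateral (P 0) (P 1) (P 2) (P 3)"
  shows "\<exists>c. 0 < 2 * c \<and> 2 * c < dist F G \<and> caustic (hyperbola F G c) P"
    and "darboux_butterfly (P 0) (P 1) (P 2) (P 3)"
proof -
  note shape = nonconvex_trajectory_shape[OF assms]
  have on: "P i \<in> ellipse F G a" and ne: "P i \<noteq> P (Suc i)" for i
    using traj unfolding billiard_trajectory_def by blast+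
  have P4: "P (i + 4) = P i" for i
    using per unfolding periodic_trajectory_def by blast
  have nums: "Suc 0 = 1" "Suc 1 = 2" "Suc 2 = 3" "Suc 3 = 4" by simp_all
  have P40: "P 4 = P 0" using P4[of 0] by simp
  note nes = ne[of 0] ne[of 1] ne[of 2] ne[of 3]
  show "darboux_butterfly (P 0) (P 1) (P 2) (P 3)"
    using symmetric_butterfly[OF _ _ _ _ nes[unfolded nums P40]] shape by blast
  \<comment> \<open>Opposite vertices have equal ordinates, so the product is the same for all four
    sides.\<close>
  have prod: "sc (P i) * sc (P (Suc i)) = - b\<^sup>2 / (a\<^sup>2 - b\<^sup>2)" for i
  proof (induction i rule: less_induct)
    case (less i)
    consider "i = 0" | "i = 1" | "i = 2" | "i = 3" | j where "i = j + 4"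
      using le_Suc_ex[of 4 i] by (force simp: add.commute)
    then show ?case
    proof cases
      case 5
      then show ?thesis using less[of j] P4[of j] P4[of "Suc j"] by simp
    qed (use shape P40 in \<open>simp_all add: nums mult.commute del: One_nat_def\<close>)
  qed
  define p where "p = a\<^sup>2 * (a\<^sup>2 - 2 * b\<^sup>2) / (a\<^sup>2 - b\<^sup>2)"
  have bpos: "0 < b\<^sup>2" "0 < a\<^sup>2" using semiaxes(1,3) by simp_all
  have ab: "2 * b\<^sup>2 < a\<^sup>2" using shape by blast
  then have "0 < p" using bpos unfolding p_def by (intro divide_pos_pos mult_pos_pos; linarith)
  have "p < f\<^sup>2"
  proof -
    \<comment> \<open>The two sides differ by \<open>b\<^sup>2 * b\<^sup>2\<close>: this is
      \<open>p = f\<^sup>2 - q\<close> with \<open>q > 0\<close>, multiplied by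
      \<open>a\<^sup>2 - b\<^sup>2\<close>.\<close>
    have "a\<^sup>2 * (a\<^sup>2 - 2 * b\<^sup>2) < (a\<^sup>2 - b\<^sup>2) * (a\<^sup>2 - b\<^sup>2)"
      using mult_pos_pos[OF bpos(1) bpos(1)] by (simp add: algebra_simps)
    then have "p < a\<^sup>2 - b\<^sup>2" using ab bpos unfolding p_def by (subst pos_divide_less_eq) linarith+
    then show ?thesis using semiaxes(4) by simp
  qed
  then have "sqrt p < f" using f_nonneg \<open>0 < p\<close> by (simp add: real_less_lsqrt)
  moreover have "caustic (hyperbola F G (sqrt p)) P"
    unfolding caustic_def p_def using side_tangent[OF on on ab prod] by blast
  ultimately show "\<exists>c. 0 < 2 * c \<and> 2 * c < dist F G \<and> caustic (hyperbola F G c) P"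
    using \<open>0 < p\<close> by (intro exI[of _ "sqrt p"]) (simp add: dist_foci)
qed

end

section \<open>Foci in arbitrary position\<close>

lemma focal_frame_exists:
  fixes F G :: "real^2"
  obtains e e' where "focal_frame F G (dist F G / 2) e e'"
proof -
  obtain e :: "real^2" where e: "norm e = 1" "F - G = dist F G *\<^sub>R e"
  proof (cases "F = G")
    case True
    then show thesis using that[of "axis 1 1"] by (simp add: norm_axis_1)
  next
    case False
    then show thesis using that[of "(F - G) /\<^sub>R dist F G"] by (simp add: dist_norm)
  qed
  have e1: "e $ 1 * e $ 1 + e $ 2 * e $ 2 = 1"
    using e(1) by (simp add: norm_eq_1 inner_vec_def sum_2)
  \<comment> \<open>The second axis is the first one turned by a right angle.\<close>
  define e' :: "real^2" where "e' = vector [- e $ 2, e $ 1]"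
  have "focal_frame F G (dist F G / 2) e e'"
  proof
    show "e \<bullet> e = 1" "e' \<bullet> e' = 1" "e \<bullet> e' = 0"
      using e1 by (simp_all add: inner_vec_def sum_2 e'_def algebra_simps)
    show "v = (v \<bullet> e) *\<^sub>R e + (v \<bullet> e') *\<^sub>R e'" for v
      unfolding vec_eq_iff forall_2
      using e1 by (simp add: inner_vec_def sum_2 e'_def) algebra
  qed (use e in simp_all)
  then show thesis by (rule that)
qed

theorem lemma7p3:
  fixes F G :: "real^2" and a :: real and P :: "nat \<Rightarrow> real^2"
  assumes "dist F G < 2 * a"
    and "billiard_trajectory (ellipse F G a) P"
    and "periodic_trajectory 4 P"
    and "\<not> convex_quadrilateral (P 0) (P 1) (P 2) (P 3)"
  shows "(\<exists>c. 0 < 2 * c \<and> 2 * c < dist F G \<and> caustic (hyperbola F G c) P) \<and>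
    darboux_butterfly (P 0) (P 1) (P 2) (P 3)"
proof -
  obtain e e' where "focal_frame F G (dist F G / 2) e e'" by (rule focal_frame_exists)
  then interpret focal_frame F G "dist F G / 2" e e' .
  interpret ellipse_frame F G "dist F G / 2" e e' a "sqrt (a\<^sup>2 - (dist F G / 2)\<^sup>2)"
    by standard (use assms(1) in simp_all)
  show ?thesis using nonconvex_trajectory[OF assms(2-4)] by blast
qed

end
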